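(* For all integers $m,n\geq 1$, the double star $S_{m,n}$ satisfies the following. If $\min\{m,n\}=1$ or $\max\{m,n\}\leq 2$, then \[\psi_{sq}(S_{m,n})=m+n+1.\] If $\min\{m,n\}\geq 2$ and $\max\{m,n\}\geq 3$, then \[\psi_{sq}(S_{m,n})=\beta_{2}(S_{m,n})=m+n.\]
   Context: All graphs are finite and simple (undirected, no loops, no multiple edges). For a graph $G=(V,E)$ and $v\in V$, $N_G[v]=\{v\}\cup\{u\in V: uv\in E\}$ is the closed neighborhood of $v$. A sub-quorum coloring of $G$ is an onto partial function $f:V\rightarrow\{1,2,\ldots,\ell\}$ such that for every vertex $v\in V$, if $f(v)$ is defined, then at least half of the vertices of $N_G[v]$ at which $f$ is defined have the same color (value of $f$) as $v$. The sub-quorum coloring number $\psi_{sq}(G)$ is the maximum value of $\ell$ over all sub-quorum colorings of $G$. A set $S\subseteq V$ is a $2$-independent set of $G$ if every vertex of $S$ has at most one neighbor in $S$; the $2$-independence number $\beta_2(G)$ is the maximum cardinality of a $2$-independent set of $G$. The star $S_n$ is the graph on $n+1$ vertices consisting of a center vertex adjacent to $n$ pairwise non-adjacent leaves. The double star $S_{m,n}$ is the graph (on $m+n+2$ vertices) obtained from the disjoint union of the stars $S_m$ and $S_n$ by adding an edge joining their centers. *)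

theory Defs
  imports "Graph_Theory.Pair_Digraph"
begin

text \<open>
  A finite simple graph is a \<^locale>\<open>pair_graph\<close>: a finite, loop-free digraph without parallel
  arcs whose arc relation is symmetric, an edge \<open>uv\<close> being the two arcs \<open>(u,v)\<close> and \<open>(v,u)\<close>.
\<close>

definition nbhd :: "'a pair_pre_digraph \<Rightarrow> 'a \<Rightarrow> 'a set" where
  "nbhd G v = {u \<in> pverts G. (u, v) \<in> parcs G}"

definition closed_nbhd :: "'a pair_pre_digraph \<Rightarrow> 'a \<Rightarrow> 'a set" where
  "closed_nbhd G v = insert v (nbhd G v)"

definition sub_quorum_coloring :: "'a pair_pre_digraph \<Rightarrow> nat \<Rightarrow> ('a \<rightharpoonup> nat) \<Rightarrow> bool" where
  "sub_quorum_coloring G l f \<longleftrightarrow>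
     dom f \<subseteq> pverts G \<and> ran f = {1..l} \<and>
     (\<forall>v \<in> dom f. card {u \<in> closed_nbhd G v. u \<in> dom f}
                    \<le> 2 * card {u \<in> closed_nbhd G v. u \<in> dom f \<and> f u = f v})"

definition sub_quorum_coloring_number :: "'a pair_pre_digraph \<Rightarrow> nat" where
  "sub_quorum_coloring_number G = Max {l. \<exists>f. sub_quorum_coloring G l f}"

definition two_independent :: "'a pair_pre_digraph \<Rightarrow> 'a set \<Rightarrow> bool" where
  "two_independent G S \<longleftrightarrow> S \<subseteq> pverts G \<and> (\<forall>v \<in> S. card (nbhd G v \<inter> S) \<le> 1)"

definition two_independence_number :: "'a pair_pre_digraph \<Rightarrow> nat" where
  "two_independence_number G = Max (card ` {S. two_independent G S})"

text \<open>The centre of \<open>star n\<close> is \<open>0\<close>, its leaves are \<open>1, \<dots>, n\<close>.\<close>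

definition star :: "nat \<Rightarrow> nat pair_pre_digraph" where
  "star n = \<lparr> pverts = {0..n}, parcs = {0} \<times> {1..n} \<union> {1..n} \<times> {0} \<rparr>"

definition disjoint_union ::
  "'a pair_pre_digraph \<Rightarrow> 'b pair_pre_digraph \<Rightarrow> ('a + 'b) pair_pre_digraph" where
  "disjoint_union G H =
     \<lparr> pverts = pverts G <+> pverts H,
       parcs = map_prod Inl Inl ` parcs G \<union> map_prod Inr Inr ` parcs H \<rparr>"

definition add_edge :: "'a pair_pre_digraph \<Rightarrow> 'a \<Rightarrow> 'a \<Rightarrow> 'a pair_pre_digraph" where
  "add_edge G u v = \<lparr> pverts = pverts G, parcs = parcs G \<union> {(u, v), (v, u)} \<rparr>"

definition double_star :: "nat \<Rightarrow> nat \<Rightarrow> (nat + nat) pair_pre_digraph" where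
  "double_star m n = add_edge (disjoint_union (star m) (star n)) (Inl 0) (Inr 0)"

lemma pair_graph_star: "pair_graph (star n)"
  by unfold_locales
    (auto simp: star_def arcs_ends_conv with_proj_def symmetric_def sym_def)

lemma pair_graph_double_star: "pair_graph (double_star m n)"
  by unfold_locales
    (auto simp: double_star_def add_edge_def disjoint_union_def star_def
       arcs_ends_conv with_proj_def symmetric_def sym_def)

lemma card_pverts_double_star: "card (pverts (double_star m n)) = m + n + 2"
  by (simp add: double_star_def add_edge_def disjoint_union_def star_def card_Plus)

text \<open>On a finite graph both maxima range over finite, nonempty sets.\<close>

lemma sub_quorum_coloring_le_card:
  assumes "finite (pverts G)" and "sub_quorum_coloring G l f"
  shows "l \<le> card (pverts G)"
proof -
  have dom: "dom f \<subseteq> pverts G" and ran: "ran f = {1..l}"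
    using assms(2) by (auto simp: sub_quorum_coloring_def)
  have fin: "finite (dom f)"
    using assms(1) dom by (rule finite_subset[rotated])
  have "ran f = (\<lambda>v. the (f v)) ` dom f"
    by (force simp: ran_def dom_def image_iff)
  then have "card (ran f) \<le> card (dom f)"
    using fin by (simp add: card_image_le)
  also have "\<dots> \<le> card (pverts G)"
    using assms(1) dom by (rule card_mono)
  finally show ?thesis
    using ran by simp
qed

lemma finite_sub_quorum_coloring:
  "finite (pverts G) \<Longrightarrow> finite {l. \<exists>f. sub_quorum_coloring G l f}"
  by (rule finite_subset[of _ "{..card (pverts G)}"]) (auto dest: sub_quorum_coloring_le_card)

lemma nonempty_sub_quorum_coloring: "{l. \<exists>f. sub_quorum_coloring G l f} \<noteq> {}"
proof -
  have "sub_quorum_coloring G 0 Map.empty"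
    by (simp add: sub_quorum_coloring_def)
  then show ?thesis
    by blast
qed

lemma finite_two_independent: "finite (pverts G) \<Longrightarrow> finite {S. two_independent G S}"
  by (rule finite_subset[of _ "Pow (pverts G)"]) (auto simp: two_independent_def)

lemma nonempty_two_independent: "{S. two_independent G S} \<noteq> {}"
proof -
  have "two_independent G {}"
    by (simp add: two_independent_def)
  then show ?thesis
    by blast
qed

end

theory Submission
  imports Defs
begin

text \<open>
  If \<open>a\<close> vertices are uncoloured and the number of coloured vertices exceeds the number of colours by
  \<open>b\<close>, then the closed neighbourhood of a coloured vertex \<open>v\<close> has at most \<open>a\<close> uncoloured vertices and
  at most \<open>1 + b\<close> vertices of the colour of \<open>v\<close>, so the quorum condition gives \<open>deg v \<le> 1 + a + 2b\<close>.
  Applied to the two centres this yields all upper bounds. The lower bounds come from giving the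
  vertices of a 2-independent set distinct colours, except for \<open>S\<^bsub>2,2\<^esub>\<close>, where the two centres share
  a colour.
\<close>

section \<open>Constructing colorings\<close>

text \<open>The quorum condition only depends on which vertices share a color, so labels
  \<open>g\<close> of any type will do. The labels in use are renumbered by a bijection
  \<open>h\<close>, and vertices outside \<open>S\<close> stay uncolored.\<close>

lemma sub_quorum_coloring_from_partition:
  assumes "finite S" and "S \<subseteq> pverts G"
    and quorum: "\<And>v. v \<in> S \<Longrightarrow>
      card (closed_nbhd G v \<inter> S) \<le> 2 * card {u \<in> closed_nbhd G v \<inter> S. g u = g v}"
  shows "\<exists>f. sub_quorum_coloring G (card (g ` S)) f"
proof -
  have "finite (g ` S)" using assms(1) by simp
  then obtain h where h: "bij_betw h (g ` S) {1..card (g ` S)}"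
    using finite_same_card_bij[of "g ` S" "{1..card (g ` S)}"] by auto
  define f where "f = (\<lambda>v. if v \<in> S then Some (h (g v)) else None)"
  have dom: "dom f = S" by (auto simp: f_def dom_def)
  have "ran f = h ` g ` S" by (auto simp: f_def ran_def)
  with h have ran: "ran f = {1..card (g ` S)}" by (simp add: bij_betw_def)
  have eq: "f u = f v \<longleftrightarrow> g u = g v" if "u \<in> S" "v \<in> S" for u v
    using that h by (auto simp: f_def bij_betw_def inj_on_eq_iff)
  have "card {u \<in> closed_nbhd G v. u \<in> dom f}
      \<le> 2 * card {u \<in> closed_nbhd G v. u \<in> dom f \<and> f u = f v}" if v: "v \<in> S" for v
  proof -
    have "{u \<in> closed_nbhd G v. u \<in> dom f} = closed_nbhd G v \<inter> S"
      "{u \<in> closed_nbhd G v. u \<in> dom f \<and> f u = f v} = {u \<in> closed_nbhd G v \<inter> S. g u = g v}"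
      using eq v by (auto simp: dom)
    with quorum[OF v] show ?thesis by simp
  qed
  with dom ran assms(2) have "sub_quorum_coloring G (card (g ` S)) f"
    by (simp add: sub_quorum_coloring_def)
  then show ?thesis by blast
qed

text \<open>When all colors on \<open>S\<close> are distinct, a vertex of \<open>S\<close> sees at
  most one colored vertex besides itself, so it alone makes up half of the colored part of its
  closed neighborhood.\<close>

lemma sub_quorum_coloring_from_two_independent:
  assumes "finite (pverts G)" and "two_independent G S"
  shows "\<exists>f. sub_quorum_coloring G (card S) f"
proof -
  have sub: "S \<subseteq> pverts G" and ind: "\<And>v. v \<in> S \<Longrightarrow> card (nbhd G v \<inter> S) \<le> 1"
    using assms(2) by (auto simp: two_independent_def)
  have fin: "finite S" using assms(1) sub by (rule finite_subset[rotated])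
  have "card (closed_nbhd G v \<inter> S) \<le> 2 * card {u \<in> closed_nbhd G v \<inter> S. id u = id v}"
    if v: "v \<in> S" for v
  proof -
    have "closed_nbhd G v \<inter> S = insert v (nbhd G v \<inter> S)"
      using v by (auto simp: closed_nbhd_def)
    then have "card (closed_nbhd G v \<inter> S) \<le> Suc (card (nbhd G v \<inter> S))"
      using fin by (simp add: card_insert_if)
    also have "\<dots> \<le> 2" using ind[OF v] by simp
    also have "{u \<in> closed_nbhd G v \<inter> S. id u = id v} = {v}"
      using v by (auto simp: closed_nbhd_def)
    then have "2 = 2 * card {u \<in> closed_nbhd G v \<inter> S. id u = id v}" by simp
    finally show ?thesis .
  qed
  from sub_quorum_coloring_from_partition[OF fin sub this] show ?thesis by simp
qed

section \<open>Bounding degrees by the number of colors\<close>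

text \<open>This is \<open>deg v <= 1 + a + 2b\<close> with
  \<open>a = card (pverts G) - card (dom f)\<close> and \<open>b = card (dom f) - l\<close>,
  rearranged so that no truncated subtraction occurs.\<close>

lemma card_closed_nbhd_sub_quorum_coloring:
  assumes fin: "finite (pverts G)" and f: "sub_quorum_coloring G l f" and v: "v \<in> dom f"
  shows "card (closed_nbhd G v) + 2 * l \<le> 2 + card (pverts G) + card (dom f)"
proof -
  have dom: "dom f \<subseteq> pverts G" and ran: "ran f = {1..l}"
    and quorum: "card (closed_nbhd G v \<inter> dom f)
      \<le> 2 * card {u \<in> closed_nbhd G v. u \<in> dom f \<and> f u = f v}"
    using f v by (auto simp: sub_quorum_coloring_def Int_def)
  have fd: "finite (dom f)" using fin dom by (rule finite_subset[rotated])
  \<comment> \<open>\<open>?A\<close> is the whole color class of \<open>v\<close>, not only its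
    part near \<open>v\<close>, because the number of colors controls just the global size of a
    class.\<close>
  let ?C = "closed_nbhd G v" and ?A = "{u \<in> dom f. f u = f v}"
  have CV: "?C \<subseteq> pverts G" using v dom by (auto simp: closed_nbhd_def nbhd_def)
  have fC: "finite ?C" using CV fin by (rule finite_subset)
  have "card ?C = card (?C \<inter> dom f) + card (?C - dom f)"
    using fC by (rule card_Int_Diff)
  also have "card (?C - dom f) \<le> card (pverts G - dom f)"
    using fin CV by (intro card_mono) auto
  also have "card (pverts G - dom f) = card (pverts G) - card (dom f)"
    using fd dom by (rule card_Diff_subset)
  finally have 1: "card ?C + card (dom f) \<le> card (?C \<inter> dom f) + card (pverts G)"
    using card_mono[OF fin dom] by linarith
  \<comment> \<open>Each of the \<open>l - 1\<close> other colors needs a vertex outside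
    \<open>?A\<close>, whence \<open>card ?A <= 1 + b\<close>.\<close>
  have "l - 1 = card ({1..l} - {the (f v)})"
    using v ran by (auto simp: ran_def card_Diff_singleton_if dom_def)
  also have "{1..l} - {the (f v)} \<subseteq> (\<lambda>u. the (f u)) ` (dom f - ?A)"
    unfolding ran[symmetric] using v by (force simp: ran_def image_iff dom_def)
  then have "card ({1..l} - {the (f v)}) \<le> card (dom f - ?A)"
    using fd by (meson card_image_le card_mono finite_Diff finite_imageI order_trans)
  also have "\<dots> = card (dom f) - card ?A"
    using fd by (intro card_Diff_subset) auto
  finally have "l + card ?A \<le> card (dom f) + 1"
    using card_mono[OF fd, of ?A] by auto
  moreover have "card {u \<in> ?C. u \<in> dom f \<and> f u = f v} \<le> card ?A"
    using fd by (intro card_mono) auto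
  ultimately show ?thesis using 1 quorum by linarith
qed

lemma card_colors_le_dom:
  assumes "finite (pverts G)" and "sub_quorum_coloring G l f"
  shows "l \<le> card (dom f)"
proof -
  have "finite (dom f)" "ran f = {1..l}"
    using assms by (auto simp: sub_quorum_coloring_def intro: finite_subset)
  moreover have "ran f = (\<lambda>v. the (f v)) ` dom f"
    by (force simp: ran_def dom_def image_iff)
  ultimately show ?thesis by (metis card_atLeastAtMost card_image_le diff_Suc_1)
qed

section \<open>Criteria for the two maxima and for 2-independence\<close>

lemma sub_quorum_coloring_number_eqI:
  assumes "finite (pverts G)" and "\<exists>f. sub_quorum_coloring G k f"
    and "\<And>l f. sub_quorum_coloring G l f \<Longrightarrow> l \<le> k"
  shows "sub_quorum_coloring_number G = k"
  unfolding sub_quorum_coloring_number_def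
  using assms finite_sub_quorum_coloring[OF assms(1)] by (intro Max_eqI) auto

lemma two_independence_number_eqI:
  assumes "finite (pverts G)" and "two_independent G S"
    and "\<And>T. two_independent G T \<Longrightarrow> card T \<le> card S"
  shows "two_independence_number G = card S"
  unfolding two_independence_number_def
  using assms finite_two_independent[OF assms(1)] by (intro Max_eqI) auto

text \<open>Inclusion in a singleton also covers an empty intersection, so concrete sets can be
  checked without computing cardinalities.\<close>

lemma two_independentI:
  assumes "S \<subseteq> pverts G" and "\<And>v. v \<in> S \<Longrightarrow> \<exists>w. nbhd G v \<inter> S \<subseteq> {w}"
  shows "two_independent G S"
  unfolding two_independent_def
proof (intro conjI ballI)
  fix v assume "v \<in> S"
  with assms(2) obtain w where "nbhd G v \<inter> S \<subseteq> {w}" by blast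
  from card_mono[OF _ this] show "card (nbhd G v \<inter> S) \<le> 1" by simp
qed (rule assms(1))

section \<open>Neighborhoods and centers of the double star\<close>

lemma pverts_double_star: "pverts (double_star m n) = {0..m} <+> {0..n}"
  by (simp add: double_star_def add_edge_def disjoint_union_def star_def)

lemma finite_pverts_double_star: "finite (pverts (double_star m n))"
  by (simp add: pverts_double_star)

lemma nbhd_double_star:
  "nbhd (double_star m n) (Inl 0) = insert (Inr 0) (Inl ` {1..m})"
  "nbhd (double_star m n) (Inr 0) = insert (Inl 0) (Inr ` {1..n})"
  "i \<in> {1..m} \<Longrightarrow> nbhd (double_star m n) (Inl i) = {Inl 0}"
  "j \<in> {1..n} \<Longrightarrow> nbhd (double_star m n) (Inr j) = {Inr 0}"
  by (force simp: nbhd_def double_star_def add_edge_def disjoint_union_def star_def)+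

lemma card_closed_nbhd_double_star:
  "card (closed_nbhd (double_star m n) (Inl 0)) = m + 2"
  "card (closed_nbhd (double_star m n) (Inr 0)) = n + 2"
  by (auto simp: closed_nbhd_def nbhd_double_star card_insert_if card_image)

text \<open>At \<open>Inl 0\<close> the degree bound reads
  \<open>m + 2 + 2 * l <= 2 + (m + n + 2) + card (dom f)\<close>. Here \<open>m\<close> cancels, so
  the left center yields a bound in \<open>n\<close>, and vice versa. The last two facts hold
  because a single uncolored vertex cannot account for both centers.\<close>

lemma sub_quorum_coloring_double_star_centres:
  assumes "sub_quorum_coloring (double_star m n) l f"
  shows "l \<le> card (dom f)" and "card (dom f) \<le> m + n + 2"
    and "Inl 0 \<in> dom f \<Longrightarrow> 2 * l \<le> n + 2 + card (dom f)"
    and "Inr 0 \<in> dom f \<Longrightarrow> 2 * l \<le> m + 2 + card (dom f)"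
    and "m + n + 1 \<le> card (dom f) \<Longrightarrow> Inl 0 \<in> dom f \<or> Inr 0 \<in> dom f"
    and "m + n + 2 \<le> card (dom f) \<Longrightarrow> Inl 0 \<in> dom f \<and> Inr 0 \<in> dom f"
proof -
  let ?G = "double_star m n"
  note fin = finite_pverts_double_star[of m n]
  have dom: "dom f \<subseteq> pverts ?G" using assms by (simp add: sub_quorum_coloring_def)
  have c: "Inl 0 \<in> pverts ?G" "Inr 0 \<in> pverts ?G" by (auto simp: pverts_double_star)
  show "l \<le> card (dom f)" using card_colors_le_dom[OF fin assms] .
  show le: "card (dom f) \<le> m + n + 2"
    using card_mono[OF fin dom] by (simp add: card_pverts_double_star)
  show "2 * l \<le> n + 2 + card (dom f)" if "Inl 0 \<in> dom f"
    using card_closed_nbhd_sub_quorum_coloring[OF fin assms that]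
    by (simp add: card_closed_nbhd_double_star card_pverts_double_star)
  show "2 * l \<le> m + 2 + card (dom f)" if "Inr 0 \<in> dom f"
    using card_closed_nbhd_sub_quorum_coloring[OF fin assms that]
    by (simp add: card_closed_nbhd_double_star card_pverts_double_star)
  show "Inl 0 \<in> dom f \<or> Inr 0 \<in> dom f" if "m + n + 1 \<le> card (dom f)"
  proof (rule ccontr)
    assume "\<not> ?thesis"
    then have "dom f \<subseteq> pverts ?G - {Inl 0, Inr 0}" using dom by auto
    then have "card (dom f) \<le> card (pverts ?G - {Inl 0, Inr 0})"
      using fin by (intro card_mono) auto
    also have "\<dots> = m + n"
      using c fin by (simp add: card_Diff_subset card_pverts_double_star)
    finally show False using that by simp
  qed
  show "Inl 0 \<in> dom f \<and> Inr 0 \<in> dom f" if "m + n + 2 \<le> card (dom f)"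
    using card_subset_eq[OF fin dom] that le c by (simp add: card_pverts_double_star)
qed

section \<open>Upper bounds for the double star\<close>

text \<open>If some vertex is uncolored, there are at most \<open>m + n + 1\<close> colored vertices
  to carry the colors. Otherwise the left center gives \<open>2 * l <= m + 2 * n + 4\<close>, which
  is below \<open>2 * (m + n + 2)\<close> since \<open>m >= 1\<close>.\<close>

lemma sub_quorum_coloring_double_star_le:
  assumes "m \<ge> 1" and "sub_quorum_coloring (double_star m n) l f"
  shows "l \<le> m + n + 1"
  using sub_quorum_coloring_double_star_centres[OF assms(2)] assms(1)
  by (cases "m + n + 2 \<le> card (dom f)") auto

lemma sub_quorum_coloring_double_star_le_leaves:
  assumes "min m n \<ge> 2" and "max m n \<ge> 3" and "sub_quorum_coloring (double_star m n) l f"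
  shows "l \<le> m + n"
proof (rule ccontr)
  note bounds = sub_quorum_coloring_double_star_centres[OF assms(3)]
  assume l: "\<not> l \<le> m + n"
  show False
  proof (cases "m + n + 2 \<le> card (dom f)")
    case True
    \<comment> \<open>No vertex is uncolored and \<open>b <= 1\<close>, so both centers, of degrees
      \<open>m + 1\<close> and \<open>n + 1\<close>, have degree at most 3.\<close>
    with bounds l have "m \<le> 2" "n \<le> 2" by auto
    with assms(2) show False by simp
  next
    case False
    \<comment> \<open>Now \<open>a = 1\<close> and \<open>b = 0\<close>: a center that is still
      colored has degree at most 2.\<close>
    with bounds l have "m \<le> 1 \<or> n \<le> 1" by fastforce
    with assms(1) show False by auto
  qed
qed

section \<open>Witnesses for the lower bounds\<close>

lemma two_independent_leaves_double_star:
  "two_independent (double_star m n) (pverts (double_star m n) - {Inl 0, Inr 0})"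
proof (rule two_independentI)
  fix v assume "v \<in> pverts (double_star m n) - {Inl 0, Inr 0}"
  then show "\<exists>w. nbhd (double_star m n) v \<inter> (pverts (double_star m n) - {Inl 0, Inr 0}) \<subseteq> {w}"
    by (cases v) (auto simp: pverts_double_star nbhd_double_star)
qed simp

text \<open>When the left center has a single leaf, deleting \<open>Inr 0\<close> is enough: the
  edge between \<open>Inl 0\<close> and \<open>Inl 1\<close> and \<open>n\<close> isolated vertices
  remain.\<close>

lemma two_independent_double_star_1_left:
  "two_independent (double_star 1 n) (pverts (double_star 1 n) - {Inr 0})"
proof (rule two_independentI)
  fix v assume v: "v \<in> pverts (double_star 1 n) - {Inr 0}"
  show "\<exists>w. nbhd (double_star 1 n) v \<inter> (pverts (double_star 1 n) - {Inr 0}) \<subseteq> {w}"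
  proof (cases "v = Inl 0")
    case True
    then show ?thesis by (intro exI[of _ "Inl 1"]) (auto simp: nbhd_double_star)
  next
    case False
    with v show ?thesis
      by (intro exI[of _ "Inl 0"], cases v) (auto simp: pverts_double_star nbhd_double_star)
  qed
qed simp

lemma two_independent_double_star_1_right:
  "two_independent (double_star m 1) (pverts (double_star m 1) - {Inl 0})"
proof (rule two_independentI)
  fix v assume v: "v \<in> pverts (double_star m 1) - {Inl 0}"
  show "\<exists>w. nbhd (double_star m 1) v \<inter> (pverts (double_star m 1) - {Inl 0}) \<subseteq> {w}"
  proof (cases "v = Inr 0")
    case True
    then show ?thesis by (intro exI[of _ "Inr 1"]) (auto simp: nbhd_double_star)
  next
    case False
    with v show ?thesis
      by (intro exI[of _ "Inr 0"], cases v) (auto simp: pverts_double_star nbhd_double_star)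
  qed
qed simp

text \<open>All six vertices are colored, and \<open>?g\<close> merges only the two centers. A
  center then shares its color with 2 of the 4 vertices in its closed neighborhood, and a leaf makes
  up half of its own.\<close>

lemma sub_quorum_coloring_double_star_2_2: "\<exists>f. sub_quorum_coloring (double_star 2 2) 5 f"
proof -
  let ?G = "double_star 2 2"
  let ?g = "\<lambda>v. if v = Inr 0 then Inl 0 else v :: nat + nat"
  have V: "pverts ?G = {Inl 0, Inl 1, Inl 2, Inr 0, Inr 1, Inr 2}"
    by (auto simp: pverts_double_star numeral_2_eq_2 le_Suc_eq)
  have "card (closed_nbhd ?G v \<inter> pverts ?G)
      \<le> 2 * card {u \<in> closed_nbhd ?G v \<inter> pverts ?G. ?g u = ?g v}"
    if v: "v \<in> pverts ?G" for v
  proof (cases "v \<in> {Inl 0, Inr 0}")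
    case True
    then have "{Inl 0, Inr 0} \<subseteq> {u \<in> closed_nbhd ?G v \<inter> pverts ?G. ?g u = ?g v}"
      by (auto simp: closed_nbhd_def nbhd_double_star V)
    from card_mono[OF _ this]
    have "2 \<le> card {u \<in> closed_nbhd ?G v \<inter> pverts ?G. ?g u = ?g v}"
      by (simp add: finite_pverts_double_star)
    moreover have "card (closed_nbhd ?G v) = 4"
      using True card_closed_nbhd_double_star[of 2 2] by auto
    moreover have "closed_nbhd ?G v \<inter> pverts ?G = closed_nbhd ?G v"
      using v by (auto simp: closed_nbhd_def nbhd_def)
    ultimately show ?thesis by simp
  next
    case False
    with v obtain w where "nbhd ?G v = {w}"
      by (fastforce simp: V nbhd_double_star)
    then have "closed_nbhd ?G v = {v, w}" by (simp add: closed_nbhd_def)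
    then have "card (closed_nbhd ?G v \<inter> pverts ?G) \<le> 2"
      using card_mono[of "{v, w}" "closed_nbhd ?G v \<inter> pverts ?G"]
      by (simp add: card_insert_if split: if_splits)
    moreover have "{v} \<subseteq> {u \<in> closed_nbhd ?G v \<inter> pverts ?G. ?g u = ?g v}"
      using v by (auto simp: closed_nbhd_def)
    from card_mono[OF _ this]
    have "1 \<le> card {u \<in> closed_nbhd ?G v \<inter> pverts ?G. ?g u = ?g v}"
      by (simp add: finite_pverts_double_star)
    ultimately show ?thesis by linarith
  qed
  from sub_quorum_coloring_from_partition[OF finite_pverts_double_star subset_refl this]
  have "\<exists>f. sub_quorum_coloring ?G (card (?g ` pverts ?G)) f" .
  moreover have "?g ` pverts ?G = {Inl 0, Inl 1, Inl 2, Inr 1, Inr 2}" by (auto simp: V)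
  then have "card (?g ` pverts ?G) = 5" by simp
  ultimately show ?thesis by metis
qed

theorem theorem15:
  fixes m n :: nat
  assumes "m \<ge> 1" and "n \<ge> 1"
  shows "(min m n = 1 \<or> max m n \<le> 2 \<longrightarrow>
            sub_quorum_coloring_number (double_star m n) = m + n + 1) \<and>
         (min m n \<ge> 2 \<and> max m n \<ge> 3 \<longrightarrow>
            sub_quorum_coloring_number (double_star m n) = two_independence_number (double_star m n) \<and>
            two_independence_number (double_star m n) = m + n)"
proof (intro conjI impI)
  let ?G = "double_star m n"
  note fin = finite_pverts_double_star[of m n]
  have c: "Inl 0 \<in> pverts ?G" "Inr 0 \<in> pverts ?G" by (auto simp: pverts_double_star)
  show "sub_quorum_coloring_number ?G = m + n + 1" if "min m n = 1 \<or> max m n \<le> 2"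
  proof (rule sub_quorum_coloring_number_eqI[OF fin])
    \<comment> \<open>The upper bound is the same in all three cases; only the witnessing colorings
      differ.\<close>
    from that assms consider "m = 1" | "n = 1" | "m = 2" "n = 2" by linarith
    then show "\<exists>f. sub_quorum_coloring ?G (m + n + 1) f"
    proof cases
      case 1
      then have "two_independent ?G (pverts ?G - {Inr 0})"
        using two_independent_double_star_1_left by simp
      from sub_quorum_coloring_from_two_independent[OF fin this] show ?thesis
        using c by (simp add: card_Diff_subset card_pverts_double_star)
    next
      case 2
      then have "two_independent ?G (pverts ?G - {Inl 0})"
        using two_independent_double_star_1_right by simp
      from sub_quorum_coloring_from_two_independent[OF fin this] show ?thesis
        using c by (simp add: card_Diff_subset card_pverts_double_star)
    next
      case 3
      with sub_quorum_coloring_double_star_2_2 show ?thesis by simp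
    qed
  qed (rule sub_quorum_coloring_double_star_le[OF assms(1)])
  assume large: "min m n \<ge> 2 \<and> max m n \<ge> 3"
  let ?L = "pverts ?G - {Inl 0, Inr 0}"
  have L: "card ?L = m + n"
    using c by (simp add: card_Diff_subset card_pverts_double_star)
  have upper: "l \<le> m + n" if "sub_quorum_coloring ?G l f" for l f
    using sub_quorum_coloring_double_star_le_leaves[OF _ _ that] large by simp
  \<comment> \<open>A 2-independent set \<open>T\<close> yields a coloring with
    \<open>card T\<close> colors, so the bound on colors also bounds \<open>card T\<close>.\<close>
  have "two_independence_number ?G = card ?L"
    using sub_quorum_coloring_from_two_independent[OF fin] upper L
    by (intro two_independence_number_eqI[OF fin two_independent_leaves_double_star]) fastforce
  then show beta: "two_independence_number ?G = m + n" by (simp add: L)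
  have "sub_quorum_coloring_number ?G = m + n"
    using sub_quorum_coloring_from_two_independent[OF fin two_independent_leaves_double_star] upper
    unfolding L by (rule sub_quorum_coloring_number_eqI[OF fin])
  then show "sub_quorum_coloring_number ?G = two_independence_number ?G" by (simp add: beta)
qed

end
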